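(* If $P$ does not lie on $\iota(l_\infty)$ (the Steiner circumellipse for $ABC$), then $Q$ is the only fixed point of $T_P$ in the finite plane.
   Context: The plane is the real Euclidean plane extended by the line at infinity $l_\infty$; points not on $l_\infty$ are ordinary (they make up the finite plane), points on it are infinite. $XY$ denotes the line through $X,Y$, and $\ell\cdot m$ the intersection of lines $\ell,m$. $ABC$ is a nondegenerate triangle with ordinary vertices, its sides being full lines; $G$ is its centroid. The complement map $K$ is the affine map fixing $G$ and sending each ordinary $Y$ to the point $K(Y)$ with $\overrightarrow{GK(Y)}=-\tfrac12\overrightarrow{GY}$; it fixes every infinite point. The anticomplementary triangle is $K^{-1}(ABC)$. $P$ is a point not lying on the extended sides of $ABC$ or of its anticomplementary triangle. The cevian triangle $DEF$ of $P$ is given by $D=AP\cdot BC$, $E=BP\cdot AC$, $F=CP\cdot AB$. Let $D_3,E_3,F_3$ be the reflections of $D,E,F$ in the midpoints of $BC,AC,AB$ respectively; the lines $AD_3,BE_3,CF_3$ meet in the isotomic conjugate $P'=\iota(P)$. The isotomcomplement of $P$ is $Q=K(P')$. $T_P$ is the affine map taking $A,B,C$ to $D,E,F$ respectively. The Steiner circumellipse of $ABC$ (which contains $A,B,C$) is the set $\iota(l_\infty)$; a point $P$ not lying on the extended sides of $ABC$ or of its anticomplementary triangle lies on it exactly when $\iota(P)$ is infinite.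
   Formalization: P is additionally assumed to be an ordinary point: for every infinite P satisfying the other conditions, T_P fixes a whole line of ordinary points, e.g. for P = (1:1:-2) in barycentric coordinates, so the claim fails there. *)

theory Defs
  imports "HOL-Analysis.Analysis"
begin

text \<open>The real Euclidean plane extended by the line at infinity. An infinite point is a
  parallel class of lines, represented by the one-dimensional subspace of direction vectors.\<close>

typedef direction = "{span {v} | v :: real^2. v \<noteq> 0}"
  by (auto intro: exI[of _ "axis 1 1"])

definition dir :: "real^2 \<Rightarrow> direction" where
  "dir v = Abs_direction (span {v})"

datatype point = Ordinary "real^2" | Infinite direction

definition line_at_infinity :: "point set" where
  "line_at_infinity = range Infinite"

definition is_line :: "point set \<Rightarrow> bool" where
  "is_line l \<longleftrightarrow> l = line_at_infinity \<or>
     (\<exists>X v. v \<noteq> 0 \<and> l = insert (Infinite (dir v)) (range (\<lambda>t. Ordinary (X + t *\<^sub>R v))))"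

text \<open>Meaningful for distinct points, respectively distinct lines.\<close>

definition join :: "point \<Rightarrow> point \<Rightarrow> point set" where
  "join X Y = (THE l. is_line l \<and> X \<in> l \<and> Y \<in> l)"

definition meet :: "point set \<Rightarrow> point set \<Rightarrow> point" where
  "meet l m = (THE X. X \<in> l \<and> X \<in> m)"

text \<open>Affine maps of the extended plane: invertible, and acting on infinite points through
  the linear part.\<close>

definition affine_map :: "(point \<Rightarrow> point) \<Rightarrow> bool" where
  "affine_map T \<longleftrightarrow> (\<exists>L c. linear L \<and> bij L \<and>
     (\<forall>x. T (Ordinary x) = Ordinary (L x + c)) \<and>
     (\<forall>v. v \<noteq> 0 \<longrightarrow> T (Infinite (dir v)) = Infinite (dir (L v))))"

primrec reflect :: "real^2 \<Rightarrow> point \<Rightarrow> point" where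
  "reflect M (Ordinary Y) = Ordinary (M - (Y - M))"
| "reflect M (Infinite d) = Infinite d"

definition centroid :: "real^2 \<Rightarrow> real^2 \<Rightarrow> real^2 \<Rightarrow> real^2" where
  "centroid A B C = (1/3) *\<^sub>R (A + B + C)"

primrec complement_map :: "real^2 \<Rightarrow> real^2 \<Rightarrow> real^2 \<Rightarrow> point \<Rightarrow> point" where
  "complement_map A B C (Ordinary Y) =
     Ordinary (centroid A B C - (1/2) *\<^sub>R (Y - centroid A B C))"
| "complement_map A B C (Infinite d) = Infinite d"

definition triangle_sides :: "point \<Rightarrow> point \<Rightarrow> point \<Rightarrow> point set" where
  "triangle_sides X Y Z = join Y Z \<union> join X Z \<union> join X Y"

definition anticomplementary_sides :: "real^2 \<Rightarrow> real^2 \<Rightarrow> real^2 \<Rightarrow> point set" where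
  "anticomplementary_sides A B C =
     (let K' = inv (complement_map A B C)
      in triangle_sides (K' (Ordinary A)) (K' (Ordinary B)) (K' (Ordinary C)))"

text \<open>The trace of \<open>P\<close> on the side \<open>YZ\<close> opposite to the vertex \<open>X\<close>.\<close>

definition cevian_foot :: "point \<Rightarrow> real^2 \<Rightarrow> real^2 \<Rightarrow> real^2 \<Rightarrow> point" where
  "cevian_foot P X Y Z = meet (join (Ordinary X) P) (join (Ordinary Y) (Ordinary Z))"

text \<open>For an infinite point of a side, the construction below is still meaningful and gives the
  opposite vertex. Hence the image of the whole line at infinity is the full Steiner
  circumellipse, including the vertices.\<close>

definition isotomic_conjugate :: "real^2 \<Rightarrow> real^2 \<Rightarrow> real^2 \<Rightarrow> point \<Rightarrow> point" where
  "isotomic_conjugate A B C P =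
     (let D\<^sub>3 = reflect (midpoint B C) (cevian_foot P A B C);
          E\<^sub>3 = reflect (midpoint A C) (cevian_foot P B A C);
          F\<^sub>3 = reflect (midpoint A B) (cevian_foot P C A B)
      in THE X. X \<in> join (Ordinary A) D\<^sub>3 \<and> X \<in> join (Ordinary B) E\<^sub>3 \<and> X \<in> join (Ordinary C) F\<^sub>3)"

definition steiner_circumellipse :: "real^2 \<Rightarrow> real^2 \<Rightarrow> real^2 \<Rightarrow> point set" where
  "steiner_circumellipse A B C = isotomic_conjugate A B C ` line_at_infinity"

definition isotomcomplement :: "real^2 \<Rightarrow> real^2 \<Rightarrow> real^2 \<Rightarrow> point \<Rightarrow> point" where
  "isotomcomplement A B C P = complement_map A B C (isotomic_conjugate A B C P)"

definition cevian_map :: "real^2 \<Rightarrow> real^2 \<Rightarrow> real^2 \<Rightarrow> point \<Rightarrow> point \<Rightarrow> point" where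
  "cevian_map A B C P = (THE T. affine_map T \<and>
     T (Ordinary A) = cevian_foot P A B C \<and>
     T (Ordinary B) = cevian_foot P B A C \<and>
     T (Ordinary C) = cevian_foot P C A B)"

end

theory Submission
  imports Defs
begin

unbundle cross3_syntax

text \<open>Use homogeneous barycentric coordinates with respect to \<open>ABC\<close>, scaled so that
  \<open>P = (x, y, z)\<close> with \<open>x + y + z = 1\<close>. In these coordinates every line, the one at infinity
  included, is the set of points orthogonal to a nonzero triple, and joins and meets are cross
  products (\<open>join_bary\<close>, \<open>meet_bline\<close>). Hence \<open>D = (0, y, z)\<close>, \<open>E = (x, 0, z)\<close>, \<open>F = (x, y, 0)\<close>
  and \<open>P' = (y z, x z, x y)\<close>. Applying the complement map gives
  \<open>Q = (x (y + z), y (x + z), z (x + y)) / (2 s)\<close> with \<open>s = y z + x z + x y\<close>.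

  The hypotheses on \<open>P\<close> become nonvanishing conditions. Off the sides of \<open>ABC\<close>, all of \<open>x\<close>, \<open>y\<close>,
  \<open>z\<close> are nonzero. Off the sides of the anticomplementary triangle, \<open>y + z\<close>, \<open>x + z\<close>, \<open>x + y\<close> are
  nonzero, so \<open>D\<close>, \<open>E\<close>, \<open>F\<close> are ordinary. Off the Steiner circumellipse, \<open>s\<close> is nonzero
  (\<open>steiner_circumellipse_bary\<close>).

  A point with coordinates \<open>(r\<^sub>1, r\<^sub>2, r\<^sub>3)\<close> of sum \<open>1\<close> is sent by \<open>T\<^sub>P\<close> to
  \<open>r\<^sub>1 D + r\<^sub>2 E + r\<^sub>3 F\<close>. With \<open>u = r\<^sub>1 / (y + z)\<close>, \<open>v = r\<^sub>2 / (x + z)\<close>, \<open>w = r\<^sub>3 / (x + y)\<close>, being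
  fixed means \<open>x (v + w) = (y + z) u\<close> and its two companions, and since \<open>x + y + z = 1\<close> this
  says \<open>(u, v, w) = (u + v + w) (x, y, z)\<close>. The solutions form one line through the
  origin. On it the sum of the \<open>r\<^sub>i\<close> is \<open>2 s (u + v + w)\<close>, and as \<open>s\<close> is nonzero exactly one
  solution has sum \<open>1\<close>, namely \<open>Q\<close> (\<open>cevian_matrix_fixed_iff\<close>).\<close>

section \<open>Points at infinity and affine combinations\<close>

lemma dir_eq_iff:
  assumes "v \<noteq> 0" "w \<noteq> 0"
  shows "dir v = dir w \<longleftrightarrow> (\<exists>k. k \<noteq> 0 \<and> w = k *\<^sub>R v)"
proof -
  have "dir v = dir w \<longleftrightarrow> span {v} = span {w}"
    unfolding dir_def using assms by (subst Abs_direction_inject) auto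
  also have "\<dots> \<longleftrightarrow> (\<exists>k. k \<noteq> 0 \<and> w = k *\<^sub>R v)"
  proof
    assume "span {v} = span {w}"
    then have "w \<in> span {v}" by (simp add: span_base)
    then obtain k where "w = k *\<^sub>R v" by (auto simp: span_singleton)
    with assms show "\<exists>k. k \<noteq> 0 \<and> w = k *\<^sub>R v" by auto
  next
    assume "\<exists>k. k \<noteq> 0 \<and> w = k *\<^sub>R v"
    then obtain k where k: "k \<noteq> 0" "w = k *\<^sub>R v" by blast
    have "w \<in> span {v}" "v \<in> span {w}"
      using k by (auto simp: span_singleton image_iff intro: exI[of _ "1 / k"])
    then show "span {v} = span {w}"
      by (intro equalityI span_minimal) simp_all
  qed
  finally show ?thesis .
qed

lemma direction_cases: obtains v where "v \<noteq> 0" "d = dir v"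
proof -
  obtain v where "v \<noteq> 0" "Rep_direction d = span {v}" using Rep_direction[of d] by blast
  then show thesis using that Rep_direction_inverse[of d] by (simp add: dir_def)
qed

definition weight :: "real^3 \<Rightarrow> real" where
  "weight r = r $ 1 + r $ 2 + r $ 3"

definition comb :: "'a::real_vector \<Rightarrow> 'a \<Rightarrow> 'a \<Rightarrow> real^3 \<Rightarrow> 'a" where
  "comb A B C r = (r $ 1) *\<^sub>R A + (r $ 2) *\<^sub>R B + (r $ 3) *\<^sub>R C"

lemma weight_linear [simp]:
  "weight (r + s) = weight r + weight s" "weight (r - s) = weight r - weight s"
  "weight (k *\<^sub>R r) = k * weight r" "weight (- r) = - weight r" "weight 0 = 0"
  by (simp_all add: weight_def algebra_simps)

lemma comb_linear [simp]:
  "comb A B C (r + s) = comb A B C r + comb A B C s"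
  "comb A B C (r - s) = comb A B C r - comb A B C s"
  "comb A B C (k *\<^sub>R r) = k *\<^sub>R comb A B C r" "comb A B C (- r) = - comb A B C r" "comb A B C 0 = 0"
  by (simp_all add: comb_def algebra_simps)

text \<open>The triples of weight \<open>0\<close> are the affine dependences, so noncollinearity of three
  points means that weighted coordinates with respect to them are unique.\<close>

lemma collinear_iff_dependent:
  "collinear {A, B, C} \<longleftrightarrow> (\<exists>r. r \<noteq> 0 \<and> weight r = 0 \<and> comb A B C r = 0)"
proof
  assume "collinear {A, B, C}"
  then consider "A = C" | u where "B = u *\<^sub>R A + (1 - u) *\<^sub>R C"
    by (auto simp: collinear_3_expand)
  then show "\<exists>r. r \<noteq> 0 \<and> weight r = 0 \<and> comb A B C r = 0"
  proof cases
    case 1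
    then show ?thesis
      by (intro exI[of _ "vector [1, 0, -1]"]) (simp add: weight_def comb_def vec_eq_iff forall_3)
  next
    case 2
    then show ?thesis
      by (intro exI[of _ "vector [u, -1, 1 - u]"]) (simp add: weight_def comb_def vec_eq_iff forall_3)
  qed
next
  assume "\<exists>r. r \<noteq> 0 \<and> weight r = 0 \<and> comb A B C r = 0"
  then obtain r where r: "r \<noteq> 0" "weight r = 0" "comb A B C r = 0" by blast
  have r3: "r $ 3 = - r $ 1 - r $ 2" using r(2) by (simp add: weight_def)
  have eq: "(r $ 1) *\<^sub>R (A - C) + (r $ 2) *\<^sub>R (B - C) = 0"
    using r(3) by (simp add: comb_def r3 algebra_simps)
  show "collinear {A, B, C}"
  proof (cases "r $ 2 = 0")
    case True
    then have "r $ 1 \<noteq> 0" using r(1) r3 by (auto simp: vec_eq_iff forall_3)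
    then show ?thesis using eq True by (simp add: collinear_3_expand)
  next
    case False
    have "(r $ 2) *\<^sub>R (B - C) = (r $ 2) *\<^sub>R ((- r $ 1 / r $ 2) *\<^sub>R (A - C))"
      using eq False by (simp add: add_eq_0_iff)
    then have "B - C = (- r $ 1 / r $ 2) *\<^sub>R (A - C)"
      by (rule real_vector.scale_left_imp_eq[OF False])
    then have "B = (- r $ 1 / r $ 2) *\<^sub>R A + (1 - (- r $ 1 / r $ 2)) *\<^sub>R C"
      by (simp add: algebra_simps)
    then show ?thesis unfolding collinear_3_expand by blast
  qed
qed

locale triangle =
  fixes A B C :: "real^2"
  assumes noncollinear: "\<not> collinear {A, B, C}"
begin

lemma coordinates_unique:
  assumes "comb A B C r = comb A B C s" "weight r = weight s"
  shows "r = s"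
proof -
  have "weight (r - s) = 0" "comb A B C (r - s) = 0" using assms by simp_all
  then show ?thesis using noncollinear collinear_iff_dependent by (metis right_minus_eq)
qed

text \<open>Coordinates and weight together embed the space of triples in the plane times the line,
  which also has dimension \<open>3\<close>.\<close>

lemma coordinates_exist: obtains r where "comb A B C r = Y" "weight r = w"
proof -
  define lift where "lift r = (comb A B C r, weight r)" for r
  have "linear lift" by (intro linearI) (simp_all add: lift_def)
  moreover have "inj lift" by (rule injI) (auto simp: lift_def intro: coordinates_unique)
  ultimately have "surj lift"
    by (intro linear_injective_imp_surjective) simp_all
  then obtain r where "lift r = (Y, w)" by (metis surjD)
  then show thesis by (intro that[of r]) (simp_all add: lift_def)
qed

end

section \<open>Affine maps given by two triangles\<close>

text \<open>The translation part enters \<^term>\<open>comb D E F r\<close> multiplied by the weight of \<open>r\<close>, so weight \<open>1\<close>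
  reproduces it exactly once.\<close>

lemma affine_map_comb:
  assumes "affine_map T" "T (Ordinary A) = Ordinary D" "T (Ordinary B) = Ordinary E"
    "T (Ordinary C) = Ordinary F" "weight r = 1"
  shows "T (Ordinary (comb A B C r)) = Ordinary (comb D E F r)"
proof -
  obtain L c where L: "linear L" "\<And>x. T (Ordinary x) = Ordinary (L x + c)"
    using assms(1) unfolding affine_map_def by blast
  have DEF: "D = L A + c" "E = L B + c" "F = L C + c" using assms L(2) by auto
  have "comb D E F r = L (comb A B C r) + weight r *\<^sub>R c"
    unfolding DEF comb_def weight_def using L(1) by (simp add: linear_add linear_scale algebra_simps)
  then show ?thesis using L(2) assms(5) by simp
qed

text \<open>The linear part, hence the action at infinity, is already visible in the finite plane.\<close>

lemma affine_map_unique: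
  assumes "affine_map T" "affine_map S" and eq: "\<And>x. T (Ordinary x) = S (Ordinary x)"
  shows "T = S"
proof
  obtain L c where L: "\<And>x. T (Ordinary x) = Ordinary (L x + c)" "linear L"
     "\<And>v. v \<noteq> 0 \<Longrightarrow> T (Infinite (dir v)) = Infinite (dir (L v))"
    using assms(1) unfolding affine_map_def by blast
  obtain M d where M: "\<And>x. S (Ordinary x) = Ordinary (M x + d)" "linear M"
     "\<And>v. v \<noteq> 0 \<Longrightarrow> S (Infinite (dir v)) = Infinite (dir (M v))"
    using assms(2) unfolding affine_map_def by blast
  have *: "L x + c = M x + d" for x using eq[of x] L(1) M(1) by simp
  from *[of 0] have "c = d" using L(2) M(2) by (simp add: linear_0)
  with * have "L = M" by auto
  fix X show "T X = S X"
    by (cases X) (use eq L(3) M(3) \<open>L = M\<close> direction_cases in \<open>metis+\<close>)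
qed

text \<open>The map is \<^term>\<open>comb D E F\<close> after the coordinates with respect to \<open>ABC\<close>; its linear part
  is the restriction to coordinates of weight \<open>0\<close> and is injective because \<open>DEF\<close> is
  nondegenerate. This makes the map \<^const>\<open>cevian_map\<close> well defined.\<close>

lemma affine_map_exists_unique:
  assumes ABC: "\<not> collinear {A, B, C}" and DEF: "\<not> collinear {D, E, F}"
  shows "\<exists>!T. affine_map T \<and> T (Ordinary A) = Ordinary D \<and> T (Ordinary B) = Ordinary E \<and>
    T (Ordinary C) = Ordinary F"
proof -
  interpret triangle A B C using ABC by unfold_locales
  interpret DEF: triangle D E F using DEF by unfold_locales
  define crd where "crd Y w = (SOME r. comb A B C r = Y \<and> weight r = w)" for Y w
  have crd: "comb A B C (crd Y w) = Y" "weight (crd Y w) = w" for Y w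
    unfolding crd_def using coordinates_exist[of Y w] someI_ex[of "\<lambda>r. comb A B C r = Y \<and> weight r = w"]
    by metis+
  have crd_eq: "crd Y w = r" if "comb A B C r = Y" "weight r = w" for Y w r
    using that by (intro coordinates_unique) (simp_all add: crd)
  define L where "L v = comb D E F (crd v 0)" for v
  define c where "c = comb D E F (crd 0 1)"
  define T where "T X = (case X of Ordinary x \<Rightarrow> Ordinary (L x + c)
      | Infinite d \<Rightarrow> Infinite (dir (L (SOME v. v \<noteq> 0 \<and> d = dir v))))" for X
  have lin: "linear L"
  proof (rule linearI)
    show "L (v + w) = L v + L w" for v w
      unfolding L_def by (subst crd_eq[of "crd v 0 + crd w 0"]) (simp_all add: crd)
    show "L (k *\<^sub>R v) = k *\<^sub>R L v" for k v
      unfolding L_def by (subst crd_eq[of "k *\<^sub>R crd v 0"]) (simp_all add: crd)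
  qed
  have inj: "inj L"
    unfolding linear_injective_0[OF lin]
  proof (intro allI impI)
    fix v assume "L v = 0"
    then have "crd v 0 = 0" by (intro DEF.coordinates_unique) (simp_all add: L_def crd)
    then show "v = 0" using crd(1)[of v 0] by simp
  qed
  then have "bij L" using lin by (simp add: bij_def linear_injective_imp_surjective)
  have L0: "L v \<noteq> 0" if "v \<noteq> 0" for v using that inj lin by (metis injD linear_0)
  have T_inf: "T (Infinite (dir v)) = Infinite (dir (L v))" if "v \<noteq> 0" for v
  proof -
    define w where "w = (SOME w. w \<noteq> 0 \<and> dir v = dir w)"
    \<comment> \<open>The representative chosen for the direction of \<open>v\<close> is only a multiple of \<open>v\<close>.\<close>
    have w: "w \<noteq> 0 \<and> dir v = dir w" unfolding w_def by (rule someI[where x = v]) (use that in simp)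
    with that have "\<exists>k. k \<noteq> 0 \<and> w = k *\<^sub>R v"
      by (intro dir_eq_iff[THEN iffD1]) simp_all
    then obtain k where k: "k \<noteq> 0" "w = k *\<^sub>R v" by (elim exE conjE)
    have "L w = k *\<^sub>R L v" unfolding k by (rule linear_scale[OF lin])
    then have "dir (L v) = dir (L w)"
      using L0 that w k(1) by (subst dir_eq_iff) auto
    then show ?thesis by (simp add: T_def w_def)
  qed
  have T: "affine_map T"
    unfolding affine_map_def
    by (intro exI[of _ L] exI[of _ c]) (use lin \<open>bij L\<close> T_inf in \<open>simp add: T_def\<close>)
  have T_comb: "T (Ordinary (comb A B C r)) = Ordinary (comb D E F r)" if "weight r = 1" for r
  proof -
    have "r = crd (comb A B C r) 0 + crd 0 1"
      using that by (intro coordinates_unique) (simp_all add: crd)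
    then show ?thesis by (simp add: T_def L_def c_def flip: comb_linear(1))
  qed
  have T_ABC: "T (Ordinary A) = Ordinary D" "T (Ordinary B) = Ordinary E" "T (Ordinary C) = Ordinary F"
    using T_comb[of "vector [1, 0, 0]"] T_comb[of "vector [0, 1, 0]"] T_comb[of "vector [0, 0, 1]"]
    by (simp_all add: comb_def weight_def)
  show ?thesis
  proof (rule ex1I[of _ T])
    fix S
    assume S: "affine_map S \<and> S (Ordinary A) = Ordinary D \<and> S (Ordinary B) = Ordinary E \<and>
      S (Ordinary C) = Ordinary F"
    show "S = T"
    proof (rule affine_map_unique)
      fix x
      obtain r where "comb A B C r = x" "weight r = 1" by (rule coordinates_exist)
      then show "S (Ordinary x) = T (Ordinary x)"
        using T_comb affine_map_comb[of S A D B E C F r] S by auto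
    qed (use S T in auto)
  qed (use T T_ABC in auto)
qed

section \<open>Homogeneous barycentric coordinates\<close>

lemma vector_3_eq_iff:
  "vector [a, b, c] = (vector [x, y, z] :: real^3) \<longleftrightarrow> a = x \<and> b = y \<and> c = z"
  by (auto simp: vec_eq_iff forall_3)

lemma vector_3_eq_0_iff: "vector [a, b, c] = (0 :: real^3) \<longleftrightarrow> a = 0 \<and> b = 0 \<and> c = 0"
  by (auto simp: vec_eq_iff forall_3)

lemma cross_vector_3:
  "vector [a, b, c] \<times> vector [x, y, z] = vector [b * z - c * y, c * x - a * z, a * y - b * x]"
  by (simp add: cross3_def)

lemma inner_vector_3: "(vector [a, b, c] :: real^3) \<bullet> r = a * r $ 1 + b * r $ 2 + c * r $ 3"
  by (simp add: inner_vec_def sum_3)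

lemma scaleR_vector_3: "k *\<^sub>R vector [a, b, c] = (vector [k * a, k * b, k * c] :: real^3)"
  by (simp add: vec_eq_iff forall_3)

lemma vector_3_cases: obtains a b c where "(r :: real^3) = vector [a, b, c]"
proof -
  have "r = vector [r $ 1, r $ 2, r $ 3]" by (simp add: vec_eq_iff forall_3)
  then show thesis by (rule that)
qed

lemma cross_zero_proportional:
  assumes "m \<times> n = 0" "m \<noteq> 0" "n \<noteq> 0"
  obtains k where "k \<noteq> 0" "n = k *\<^sub>R m"
proof -
  from assms obtain k where "n = k *\<^sub>R m" by (auto simp: cross_eq_0 collinear_lemma)
  moreover from this assms(3) have "k \<noteq> 0" by auto
  ultimately show thesis by (intro that)
qed

lemma weight_eq_inner: "weight r = vector [1, 1, 1] \<bullet> r"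
  by (simp add: weight_def inner_vector_3)

context triangle
begin

text \<open>The point of the extended plane with homogeneous barycentric coordinates \<open>r\<close>; the points at
  infinity are those of weight \<open>0\<close>. The value at \<open>0\<close> is not meaningful.\<close>

definition bary :: "real^3 \<Rightarrow> point" where
  "bary r = (if weight r = 0 then Infinite (dir (comb A B C r))
             else Ordinary ((1 / weight r) *\<^sub>R comb A B C r))"

lemma comb_nonzero: "comb A B C r \<noteq> 0" if "weight r = 0" "r \<noteq> 0"
  using coordinates_unique[of r 0] that by auto

lemma bary_scale:
  assumes "k \<noteq> 0" "p \<noteq> 0"
  shows "bary (k *\<^sub>R p) = bary p"
proof (cases "weight p = 0")
  case True
  then have "dir (k *\<^sub>R comb A B C p) = dir (comb A B C p)"
    using assms comb_nonzero[OF True] by (intro sym[OF dir_eq_iff[THEN iffD2]]) auto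
  then show ?thesis using True by (simp add: bary_def)
qed (use assms in \<open>simp add: bary_def\<close>)

lemma bary_eqE:
  assumes "bary p = bary q" "p \<noteq> 0" "q \<noteq> 0"
  obtains k where "k \<noteq> 0" "q = k *\<^sub>R p"
proof (cases "weight p = 0")
  case True
  then have wq: "weight q = 0" using assms(1) by (auto simp: bary_def split: if_splits)
  have "dir (comb A B C p) = dir (comb A B C q)"
    using assms(1) True wq by (simp add: bary_def)
  then have "\<exists>k. k \<noteq> 0 \<and> comb A B C q = k *\<^sub>R comb A B C p"
    using comb_nonzero True wq assms by (intro dir_eq_iff[THEN iffD1]) simp_all
  then obtain k where k: "k \<noteq> 0" "comb A B C q = k *\<^sub>R comb A B C p" by blast
  have "q = k *\<^sub>R p" by (rule coordinates_unique) (use k True wq in simp_all)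
  with k(1) show thesis by (rule that)
next
  case False
  then have wq: "weight q \<noteq> 0" using assms(1) by (auto simp: bary_def split: if_splits)
  have eq: "(1 / weight q) *\<^sub>R comb A B C q = (1 / weight p) *\<^sub>R comb A B C p"
    using assms(1) False wq by (simp add: bary_def)
  have "(1 / weight q) *\<^sub>R q = (1 / weight p) *\<^sub>R p"
    by (rule coordinates_unique) (use eq False wq in simp_all)
  then have "weight q *\<^sub>R (1 / weight q) *\<^sub>R q = weight q *\<^sub>R (1 / weight p) *\<^sub>R p" by (rule arg_cong)
  then have "q = (weight q / weight p) *\<^sub>R p" using wq by simp
  then show thesis using that False wq by (metis divide_eq_0_iff)
qed

lemma bary_surj: obtains p where "p \<noteq> 0" "X = bary p"
proof (cases X)
  case (Ordinary x)
  obtain p where "comb A B C p = x" "weight p = 1" by (rule coordinates_exist)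
  then have "p \<noteq> 0" "X = bary p" by (auto simp: Ordinary bary_def)
  then show thesis by (rule that)
next
  case (Infinite d)
  obtain v where v: "v \<noteq> 0" "d = dir v" by (rule direction_cases)
  obtain p where "comb A B C p = v" "weight p = 0" by (rule coordinates_exist)
  then have "p \<noteq> 0" "X = bary p" using v by (auto simp: Infinite bary_def)
  then show thesis by (rule that)
qed

lemma bary_infinite_iff: "bary p \<in> line_at_infinity \<longleftrightarrow> weight p = 0"
  by (auto simp: bary_def line_at_infinity_def)

lemma vertices_bary:
  "Ordinary A = bary (vector [1, 0, 0])" "Ordinary B = bary (vector [0, 1, 0])"
  "Ordinary C = bary (vector [0, 0, 1])"
  by (simp_all add: bary_def weight_def comb_def)

text \<open>The line with homogeneous barycentric coordinates \<open>n\<close>: incidence is orthogonality to the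
  coordinates of the point.\<close>

definition bline :: "real^3 \<Rightarrow> point set" where
  "bline n = {bary r | r. r \<noteq> 0 \<and> n \<bullet> r = 0}"

lemma bary_in_bline_iff:
  assumes "p \<noteq> 0" shows "bary p \<in> bline n \<longleftrightarrow> n \<bullet> p = 0"
proof
  assume "bary p \<in> bline n"
  then obtain r where "bary p = bary r" "r \<noteq> 0" "n \<bullet> r = 0" by (auto simp: bline_def)
  with assms show "n \<bullet> p = 0" by (auto elim: bary_eqE)
qed (use assms in \<open>auto simp: bline_def\<close>)

lemma bline_scale: "bline (k *\<^sub>R n) = bline n" if "k \<noteq> 0"
  using that by (simp add: bline_def)

lemma bline_infinity: "bline (vector [1, 1, 1]) = line_at_infinity"
proof (rule set_eqI)
  fix X
  obtain p where "p \<noteq> 0" "X = bary p" by (rule bary_surj)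
  then show "X \<in> bline (vector [1, 1, 1]) \<longleftrightarrow> X \<in> line_at_infinity"
    by (simp add: bary_in_bline_iff bary_infinite_iff weight_eq_inner)
qed

text \<open>A triple is orthogonal to the cross product of two independent triples exactly when it is a
  linear combination of them. With a point \<open>x\<close> and a direction \<open>d\<close> these combinations are the
  points of the parametrised line.\<close>

lemma bline_affine:
  assumes x: "weight x = 1" and d: "weight d = 0" "d \<noteq> 0"
  shows "bline (x \<times> d) =
    insert (Infinite (dir (comb A B C d))) (range (\<lambda>t. Ordinary (comb A B C x + t *\<^sub>R comb A B C d)))"
    (is "_ = ?R")
proof
  have bary_d: "bary d = Infinite (dir (comb A B C d))" using d by (simp add: bary_def)
  have bary_x: "bary (x + t *\<^sub>R d) = Ordinary (comb A B C x + t *\<^sub>R comb A B C d)" for t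
    using x d by (simp add: bary_def)
  have "x + t *\<^sub>R d \<noteq> 0" for t
  proof
    assume "x + t *\<^sub>R d = 0"
    then have "weight (x + t *\<^sub>R d) = 0" by simp
    then show False using x d by simp
  qed
  then show "?R \<subseteq> bline (x \<times> d)"
    unfolding bary_d[symmetric] bary_x[symmetric] using d
    by (auto simp: bary_in_bline_iff dot_cross_self inner_add_right)
  show "bline (x \<times> d) \<subseteq> ?R"
  proof
    fix X assume "X \<in> bline (x \<times> d)"
    then obtain r where r: "r \<noteq> 0" "(x \<times> d) \<bullet> r = 0" "X = bary r" by (auto simp: bline_def)
    define s where "s = r - weight r *\<^sub>R x"
    have ws: "weight s = 0" using x by (simp add: s_def)
    have "(x \<times> d) \<bullet> s = 0" using r(2) by (simp add: s_def inner_diff_right dot_cross_self)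
    then have dsx: "(d \<times> s) \<bullet> x = 0" by (simp add: cross_triple)
    \<comment> \<open>Both \<open>d\<close> and \<open>s\<close> have weight \<open>0\<close>, so \<open>d \<times> s\<close> is proportional to \<open>(1, 1, 1)\<close>, which is
      not orthogonal to \<open>x\<close>.\<close>
    have "d \<times> s = 0"
    proof (rule ccontr)
      assume "d \<times> s \<noteq> 0"
      moreover have "vector [1, 1, 1] \<times> (d \<times> s) = 0"
        using ws d by (simp add: Lagrange weight_eq_inner)
      moreover have "vector [1, 1, 1] \<noteq> (0 :: real^3)" by (simp add: vector_3_eq_0_iff)
      ultimately obtain k where "k \<noteq> 0" "d \<times> s = k *\<^sub>R vector [1, 1, 1]"
        using cross_zero_proportional by blast
      then show False using dsx x by (simp add: weight_eq_inner)
    qed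
    then obtain k where "s = k *\<^sub>R d" using d by (auto simp: cross_eq_0 collinear_lemma)
    then have r_eq: "r = weight r *\<^sub>R x + k *\<^sub>R d" by (simp add: s_def algebra_simps)
    show "X \<in> ?R"
    proof (cases "weight r = 0")
      case True
      then have "r = k *\<^sub>R d" "k \<noteq> 0" using r_eq r(1) by auto
      then show ?thesis using d by (simp add: r(3) bary_scale bary_d)
    next
      case False
      have "x + (k / weight r) *\<^sub>R d = (1 / weight r) *\<^sub>R (weight r *\<^sub>R x + k *\<^sub>R d)"
        using False by (simp add: scaleR_add_right)
      also have "\<dots> = (1 / weight r) *\<^sub>R r" by (simp flip: r_eq)
      finally have "bary (x + (k / weight r) *\<^sub>R d) = X" using False r by (simp add: bary_scale)
      then show ?thesis by (auto simp: bary_x)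
    qed
  qed
qed

text \<open>Ordinary lines and the line at infinity are thereby put on the same footing. The coordinates
  of the line at infinity are proportional to \<open>(1, 1, 1)\<close>; any other line \<open>n\<close> has the point
  at infinity \<open>n \<times> (1, 1, 1)\<close>.\<close>

lemma is_line_iff_bline: "is_line l \<longleftrightarrow> (\<exists>n. n \<noteq> 0 \<and> l = bline n)"
proof
  assume "is_line l"
  then consider "l = line_at_infinity"
    | X v where "v \<noteq> 0" "l = insert (Infinite (dir v)) (range (\<lambda>t. Ordinary (X + t *\<^sub>R v)))"
    unfolding is_line_def by blast
  then show "\<exists>n. n \<noteq> 0 \<and> l = bline n"
  proof cases
    case 1
    then show ?thesis
      by (intro exI[of _ "vector [1, 1, 1]"]) (simp add: bline_infinity vector_3_eq_0_iff)
  next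
    case 2
    obtain x where x: "comb A B C x = X" "weight x = 1" by (rule coordinates_exist)
    obtain d where d: "comb A B C d = v" "weight d = 0" by (rule coordinates_exist)
    have "d \<noteq> 0" using d(1) \<open>v \<noteq> 0\<close> by auto
    have "l = bline (x \<times> d)" using bline_affine[OF x(2) d(2) \<open>d \<noteq> 0\<close>] 2 x d by simp
    moreover have "x \<times> d \<noteq> 0"
    proof
      assume "x \<times> d = 0"
      moreover have "x \<noteq> 0" using x(2) by auto
      ultimately obtain k where "k \<noteq> 0" "d = k *\<^sub>R x"
        using \<open>d \<noteq> 0\<close> cross_zero_proportional by blast
      then show False using x(2) d(2) by simp
    qed
    ultimately show ?thesis by blast
  qed
next
  assume "\<exists>n. n \<noteq> 0 \<and> l = bline n"
  then obtain n where n: "n \<noteq> 0" "l = bline n" by blast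
  define u :: "real^3" where "u = vector [1, 1, 1]"
  define d where "d = n \<times> u"
  show "is_line l"
  proof (cases "d = 0")
    case True
    have "u \<noteq> 0" by (simp add: u_def vector_3_eq_0_iff)
    have "u \<times> n = 0" using True cross_skew[of u n] by (simp add: d_def)
    then obtain k where "k \<noteq> 0" "n = k *\<^sub>R u"
      using \<open>u \<noteq> 0\<close> n(1) by (rule cross_zero_proportional)
    then show ?thesis by (simp add: n bline_scale u_def bline_infinity is_line_def)
  next
    case False
    have wd: "weight d = 0" by (simp add: weight_eq_inner d_def dot_cross_self flip: u_def)
    \<comment> \<open>The triple \<open>n \<times> d\<close> is orthogonal to \<open>n\<close> and has nonzero weight, so after normalisation
      it is an ordinary point of the line.\<close>
    have "weight (n \<times> d) = - (d \<bullet> d)"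
    proof -
      have "weight (n \<times> d) = (n \<times> d) \<bullet> u" by (simp add: weight_eq_inner u_def inner_commute)
      also have "\<dots> = (u \<times> n) \<bullet> d" by (metis cross_triple)
      finally show ?thesis by (simp add: d_def cross_skew[of u n])
    qed
    moreover have "d \<bullet> d \<noteq> 0" using False by simp
    moreover define x where "x = (- 1 / (d \<bullet> d)) *\<^sub>R (n \<times> d)"
    ultimately have x: "weight x = 1" by simp
    have "(n \<times> d) \<times> d = - (d \<bullet> d) *\<^sub>R n"
    proof -
      have "(n \<times> d) \<times> d = d \<times> (d \<times> n)"
        by (metis cross_skew cross_minus_right)
      also have "\<dots> = - (d \<bullet> d) *\<^sub>R n" by (simp add: Lagrange d_def dot_cross_self)
      finally show ?thesis .
    qed
    then have "x \<times> d = n" using \<open>d \<bullet> d \<noteq> 0\<close> by (simp add: x_def cross_mult_left)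
    then have "l = insert (Infinite (dir (comb A B C d)))
        (range (\<lambda>t. Ordinary (comb A B C x + t *\<^sub>R comb A B C d)))"
      using bline_affine[OF x wd False] n by simp
    then show ?thesis unfolding is_line_def using comb_nonzero[OF wd False] by blast
  qed
qed

text \<open>A line through both points has coordinates orthogonal to \<open>p\<close> and \<open>q\<close>, hence proportional
  to \<open>p \<times> q\<close>. Dually, two lines meet in the cross product of their coordinates.\<close>

lemma join_bary:
  assumes "p \<times> q \<noteq> 0"
  shows "join (bary p) (bary q) = bline (p \<times> q)"
  unfolding join_def
proof (rule the_equality)
  have pq: "p \<noteq> 0" "q \<noteq> 0" using assms by auto
  then show "is_line (bline (p \<times> q)) \<and> bary p \<in> bline (p \<times> q) \<and> bary q \<in> bline (p \<times> q)"
    using assms by (auto simp: is_line_iff_bline bary_in_bline_iff dot_cross_self)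
  fix l assume l: "is_line l \<and> bary p \<in> l \<and> bary q \<in> l"
  then obtain n where n: "n \<noteq> 0" "l = bline n" by (auto simp: is_line_iff_bline)
  have "n \<bullet> p = 0" "n \<bullet> q = 0" using l n pq by (auto simp: bary_in_bline_iff)
  then have "n \<times> (p \<times> q) = 0" by (simp add: Lagrange)
  then obtain k where "k \<noteq> 0" "p \<times> q = k *\<^sub>R n"
    using n(1) assms by (rule cross_zero_proportional)
  then show "l = bline (p \<times> q)" using n by (simp add: bline_scale)
qed

lemma meet_unique:
  assumes "m \<times> n \<noteq> 0" "X \<in> bline m" "X \<in> bline n"
  shows "X = bary (m \<times> n)"
proof -
  obtain p where p: "p \<noteq> 0" "X = bary p" by (rule bary_surj)
  then have "m \<bullet> p = 0" "n \<bullet> p = 0" using assms by (auto simp: bary_in_bline_iff)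
  then have "p \<times> (m \<times> n) = 0" by (simp add: Lagrange inner_commute)
  then obtain k where "k \<noteq> 0" "m \<times> n = k *\<^sub>R p"
    using p(1) assms(1) by (rule cross_zero_proportional)
  then show ?thesis using p by (simp add: bary_scale)
qed

lemma meet_bline:
  assumes "m \<times> n \<noteq> 0"
  shows "meet (bline m) (bline n) = bary (m \<times> n)"
  unfolding meet_def
proof (rule the_equality)
  show "bary (m \<times> n) \<in> bline m \<and> bary (m \<times> n) \<in> bline n"
    using assms by (simp add: bary_in_bline_iff dot_cross_self)
qed (use assms meet_unique in blast)

end

section \<open>The cevian triangle and the isotomcomplement in coordinates\<close>

context triangle
begin

lemma side_lines:
  "join (Ordinary B) (Ordinary C) = bline (vector [1, 0, 0])"
  "join (Ordinary A) (Ordinary C) = bline (vector [0, -1, 0])"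
  "join (Ordinary A) (Ordinary B) = bline (vector [0, 0, 1])"
  by (simp_all add: vertices_bary join_bary cross_vector_3 vector_3_eq_0_iff)

lemma in_triangle_sides_iff:
  assumes "vector [x, y, z] \<noteq> (0 :: real^3)"
  shows "bary (vector [x, y, z]) \<in> triangle_sides (Ordinary A) (Ordinary B) (Ordinary C) \<longleftrightarrow>
    x = 0 \<or> y = 0 \<or> z = 0"
  using assms by (simp add: triangle_sides_def side_lines bary_in_bline_iff inner_vector_3)

lemma anticomplementary_vertices:
  "inv (complement_map A B C) (Ordinary A) = bary (vector [-1, 1, 1])"
  "inv (complement_map A B C) (Ordinary B) = bary (vector [1, -1, 1])"
  "inv (complement_map A B C) (Ordinary C) = bary (vector [1, 1, -1])"
proof -
  have "inj (complement_map A B C)"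
  proof (rule injI)
    fix X Y assume "complement_map A B C X = complement_map A B C Y"
    then show "X = Y" by (cases X; cases Y) auto
  qed
  then show "inv (complement_map A B C) (Ordinary A) = bary (vector [-1, 1, 1])"
    "inv (complement_map A B C) (Ordinary B) = bary (vector [1, -1, 1])"
    "inv (complement_map A B C) (Ordinary C) = bary (vector [1, 1, -1])"
    by (auto intro!: inv_f_eq simp: bary_def weight_def comb_def centroid_def vec_eq_iff field_simps)
qed

lemma in_anticomplementary_sides_iff:
  assumes "vector [x, y, z] \<noteq> (0 :: real^3)"
  shows "bary (vector [x, y, z]) \<in> anticomplementary_sides A B C \<longleftrightarrow>
    y + z = 0 \<or> x + z = 0 \<or> x + y = 0"
  using assms
  by (auto simp: anticomplementary_sides_def Let_def triangle_sides_def anticomplementary_vertices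
      join_bary cross_vector_3 vector_3_eq_0_iff bary_in_bline_iff inner_vector_3)

lemma bary_vector_cong:
  assumes "vector [x', y', z'] = k *\<^sub>R (vector [x, y, z] :: real^3)" "k \<noteq> 0"
  shows "bary (vector [x', y', z']) = bary (vector [x, y, z])"
proof (cases "vector [x, y, z] = (0 :: real^3)")
  case False
  then show ?thesis using assms by (simp add: bary_scale)
qed (use assms in simp)

lemma cevian_feet:
  assumes "x \<noteq> 0" "y \<noteq> 0" "z \<noteq> 0"
  shows "cevian_foot (bary (vector [x, y, z])) A B C = bary (vector [0, y, z])"
    "cevian_foot (bary (vector [x, y, z])) B A C = bary (vector [x, 0, z])"
    "cevian_foot (bary (vector [x, y, z])) C A B = bary (vector [x, y, 0])"
proof -
  have "bary (vector [-x, 0, -z]) = bary (vector [x, 0, z])"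
    by (rule bary_vector_cong[of _ _ _ "-1"]) (simp_all add: scaleR_vector_3 vector_3_eq_iff)
  then show "cevian_foot (bary (vector [x, y, z])) A B C = bary (vector [0, y, z])"
    "cevian_foot (bary (vector [x, y, z])) B A C = bary (vector [x, 0, z])"
    "cevian_foot (bary (vector [x, y, z])) C A B = bary (vector [x, y, 0])"
    using assms unfolding cevian_foot_def side_lines
    by (simp_all add: vertices_bary join_bary meet_bline cross_vector_3 vector_3_eq_0_iff)
qed

text \<open>The hypothesis says that \<open>p\<close> and \<open>q\<close> have the midpoint of \<open>YZ\<close> as their midpoint when the
  weight is nonzero, and that \<open>q = - p\<close> when it is zero. Reflection keeps a point at infinity, so
  both cases obey one formula.\<close>

lemma reflect_midpoint_bary:
  assumes "p \<noteq> 0" and w: "weight q = weight p"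
    and pq: "comb A B C p + comb A B C q = weight p *\<^sub>R (Y + Z)"
  shows "reflect (midpoint Y Z) (bary p) = bary q"
proof (cases "weight p = 0")
  case True
  have "q = (-1) *\<^sub>R p"
    by (rule coordinates_unique) (use True w pq in \<open>simp_all add: add_eq_0_iff\<close>)
  then have "bary q = bary p" using bary_scale[of "-1" p] assms(1) by simp
  then show ?thesis using True by (simp add: bary_def)
next
  case False
  have "(1 / weight p) *\<^sub>R (comb A B C p + comb A B C q) = Y + Z" using False by (simp add: pq)
  then have "(1 / weight p) *\<^sub>R comb A B C q = Y + Z - (1 / weight p) *\<^sub>R comb A B C p"
    by (simp add: scaleR_add_right algebra_simps)
  moreover have "midpoint Y Z + midpoint Y Z = Y + Z"
    by (simp add: midpoint_def flip: scaleR_2)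
  ultimately show ?thesis using False w by (simp add: bary_def algebra_simps)
qed

lemma reflect_feet:
  assumes "x \<noteq> 0" "y \<noteq> 0" "z \<noteq> 0"
  shows "reflect (midpoint B C) (bary (vector [0, y, z])) = bary (vector [0, z, y])"
    "reflect (midpoint A C) (bary (vector [x, 0, z])) = bary (vector [z, 0, x])"
    "reflect (midpoint A B) (bary (vector [x, y, 0])) = bary (vector [y, x, 0])"
  using assms by (auto intro!: reflect_midpoint_bary
      simp: vector_3_eq_0_iff weight_def comb_def algebra_simps)

text \<open>Reflection of the feet swaps their two nonzero coordinates, which inverts all ratios: the
  coordinates of the isotomic conjugate are \<open>(1/x, 1/y, 1/z)\<close>, cleared of denominators.\<close>

lemma isotomic_conjugate_bary:
  assumes "x \<noteq> 0" "y \<noteq> 0" "z \<noteq> 0"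
  shows "isotomic_conjugate A B C (bary (vector [x, y, z])) = bary (vector [y * z, x * z, x * y])"
proof -
  have lines: "join (Ordinary A) (bary (vector [0, z, y])) = bline (vector [0, -y, z])"
    "join (Ordinary B) (bary (vector [z, 0, x])) = bline (vector [x, 0, -z])"
    "join (Ordinary C) (bary (vector [y, x, 0])) = bline (vector [-x, y, 0])"
    using assms by (simp_all add: vertices_bary join_bary cross_vector_3 vector_3_eq_0_iff)
  have meet: "vector [0, -y, z] \<times> vector [x, 0, -z] = vector [y * z, x * z, x * y]"
    by (simp add: cross_vector_3 mult.commute)
  show ?thesis
    unfolding isotomic_conjugate_def Let_def cevian_feet[OF assms] reflect_feet[OF assms] lines
  proof (rule the_equality)
    show "bary (vector [y * z, x * z, x * y]) \<in> bline (vector [0, -y, z]) \<and>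
      bary (vector [y * z, x * z, x * y]) \<in> bline (vector [x, 0, -z]) \<and>
      bary (vector [y * z, x * z, x * y]) \<in> bline (vector [-x, y, 0])"
      using assms by (simp add: bary_in_bline_iff vector_3_eq_0_iff inner_vector_3)
    fix X
    assume "X \<in> bline (vector [0, -y, z]) \<and> X \<in> bline (vector [x, 0, -z]) \<and> X \<in> bline (vector [-x, y, 0])"
    then show "X = bary (vector [y * z, x * z, x * y])"
      using meet_unique[of "vector [0, -y, z]" "vector [x, 0, -z]" X] assms
      by (simp add: meet vector_3_eq_0_iff)
  qed
qed

text \<open>Such a point is the isotomic conjugate of its own isotomic conjugate, which is at infinity.\<close>

lemma steiner_circumellipse_bary:
  assumes "x \<noteq> 0" "y \<noteq> 0" "z \<noteq> 0" "y * z + x * z + x * y = 0"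
  shows "bary (vector [x, y, z]) \<in> steiner_circumellipse A B C"
proof -
  let ?R = "bary (vector [y * z, x * z, x * y])"
  have "isotomic_conjugate A B C ?R = bary (vector [x * z * (x * y), y * z * (x * y), y * z * (x * z)])"
    using assms by (intro isotomic_conjugate_bary) simp_all
  also have "\<dots> = bary (vector [x, y, z])"
    using assms by (intro bary_vector_cong[of _ _ _ "x * y * z"])
      (simp_all add: scaleR_vector_3 vector_3_eq_iff)
  finally have "bary (vector [x, y, z]) = isotomic_conjugate A B C ?R" by (rule sym)
  moreover have "?R \<in> line_at_infinity"
    unfolding bary_infinite_iff using assms by (simp add: weight_def)
  ultimately show ?thesis unfolding steiner_circumellipse_def by (rule image_eqI)
qed

text \<open>The complement map replaces the normalised coordinates \<open>r\<close> by \<open>((1, 1, 1) - r) / 2\<close>.\<close>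

lemma isotomcomplement_bary:
  assumes "x \<noteq> 0" "y \<noteq> 0" "z \<noteq> 0" and s: "y * z + x * z + x * y = s" "s \<noteq> 0"
  shows "isotomcomplement A B C (bary (vector [x, y, z])) =
    Ordinary (comb A B C ((1 / (2 * s)) *\<^sub>R vector [x * (y + z), y * (x + z), z * (x + y)]))"
proof -
  have "centroid A B C - (1/2) *\<^sub>R ((1 / s) *\<^sub>R comb A B C (vector [y * z, x * z, x * y]) - centroid A B C)
    = comb A B C ((1 / 2) *\<^sub>R vector [1, 1, 1] - (1 / (2 * s)) *\<^sub>R vector [y * z, x * z, x * y])"
    by (simp add: centroid_def comb_def vec_eq_iff field_simps)
  also have "(1 / 2) *\<^sub>R vector [1, 1, 1] - (1 / (2 * s)) *\<^sub>R vector [y * z, x * z, x * y] =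
    (1 / (2 * s)) *\<^sub>R (vector [x * (y + z), y * (x + z), z * (x + y)] :: real^3)"
    using s(2) by (simp add: vec_eq_iff forall_3 field_simps flip: s(1))
  finally show ?thesis
    using s unfolding isotomcomplement_def isotomic_conjugate_bary[OF assms(1-3)]
    by (simp add: bary_def weight_def)
qed

end

section \<open>Fixed points of the affine map to the cevian triangle\<close>

text \<open>The action of \<open>T\<^sub>P\<close> on coordinates: the columns are the coordinates of \<open>D\<close>, \<open>E\<close> and \<open>F\<close>, scaled
  to weight \<open>1\<close>.\<close>

definition cevian_matrix :: "real \<Rightarrow> real \<Rightarrow> real \<Rightarrow> real^3 \<Rightarrow> real^3" where
  "cevian_matrix x y z r =
     (let u = r $ 1 / (y + z); v = r $ 2 / (x + z); w = r $ 3 / (x + y)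
      in vector [x * (v + w), y * (u + w), z * (u + v)])"

lemma weight_cevian_matrix:
  assumes "y + z \<noteq> 0" "x + z \<noteq> 0" "x + y \<noteq> 0"
  shows "weight (cevian_matrix x y z r) = weight r"
proof -
  define u v w where "u = r $ 1 / (y + z)" and "v = r $ 2 / (x + z)" and "w = r $ 3 / (x + y)"
  have r: "r $ 1 = (y + z) * u" "r $ 2 = (x + z) * v" "r $ 3 = (x + y) * w"
    using assms by (simp_all add: u_def v_def w_def)
  have "weight (cevian_matrix x y z r) = x * (v + w) + y * (u + w) + z * (u + v)"
    by (simp add: weight_def cevian_matrix_def Let_def u_def v_def w_def)
  then show ?thesis by (simp add: weight_def r algebra_simps)
qed

lemma cevian_matrix_eq_0D:
  assumes "x \<noteq> 0" "y \<noteq> 0" "z \<noteq> 0" "y + z \<noteq> 0" "x + z \<noteq> 0" "x + y \<noteq> 0"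
    and "cevian_matrix x y z r = 0"
  shows "r = 0"
proof -
  have "r $ 2 / (x + z) + r $ 3 / (x + y) = 0" "r $ 1 / (y + z) + r $ 3 / (x + y) = 0"
    "r $ 1 / (y + z) + r $ 2 / (x + z) = 0"
    using assms by (simp_all add: cevian_matrix_def Let_def vec_eq_iff forall_3)
  then have "r $ 1 / (y + z) = 0" "r $ 2 / (x + z) = 0" "r $ 3 / (x + y) = 0" by linarith+
  then show ?thesis using assms by (simp add: vec_eq_iff forall_3)
qed

text \<open>In the rescaled unknowns \<open>u\<close>, \<open>v\<close>, \<open>w\<close> of \<^const>\<open>cevian_matrix\<close> the fixed point equations say that
  \<open>(u, v, w) = \<sigma> (x, y, z)\<close> with \<open>\<sigma> = u + v + w\<close>, because \<open>x + y + z = 1\<close>. The weight of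
  \<open>r\<close> is then \<open>2 s \<sigma>\<close>, so weight \<open>1\<close> forces \<open>\<sigma> = 1 / (2 s)\<close>.\<close>

lemma cevian_matrix_fixed_iff:
  assumes sums: "y + z \<noteq> 0" "x + z \<noteq> 0" "x + y \<noteq> 0" and xyz_1: "x + y + z = 1"
    and s: "y * z + x * z + x * y = s" "s \<noteq> 0" and r_1: "weight r = 1"
  shows "cevian_matrix x y z r = r \<longleftrightarrow>
    r = (1 / (2 * s)) *\<^sub>R vector [x * (y + z), y * (x + z), z * (x + y)]"
proof -
  define u v w where "u = r $ 1 / (y + z)" and "v = r $ 2 / (x + z)" and "w = r $ 3 / (x + y)"
  have r: "r $ 1 = (y + z) * u" "r $ 2 = (x + z) * v" "r $ 3 = (x + y) * w"
    using sums by (simp_all add: u_def v_def w_def)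
  have yz: "y + z = 1 - x" "x + z = 1 - y" "x + y = 1 - z" using xyz_1 by simp_all
  have "cevian_matrix x y z r = r \<longleftrightarrow>
      x * (v + w) = (y + z) * u \<and> y * (u + w) = (x + z) * v \<and> z * (u + v) = (x + y) * w"
    by (simp add: cevian_matrix_def Let_def vec_eq_iff forall_3 flip: u_def v_def w_def)
      (simp add: r)
  also have "\<dots> \<longleftrightarrow> u = x * (u + v + w) \<and> v = y * (u + v + w) \<and> w = z * (u + v + w)"
    unfolding yz by (auto simp: algebra_simps)
  also have "\<dots> \<longleftrightarrow> u = x / (2 * s) \<and> v = y / (2 * s) \<and> w = z / (2 * s)"
  proof
    assume uvw: "u = x * (u + v + w) \<and> v = y * (u + v + w) \<and> w = z * (u + v + w)"
    define \<sigma> where "\<sigma> = u + v + w"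
    have uvw: "u = x * \<sigma>" "v = y * \<sigma>" "w = z * \<sigma>" using uvw by (auto simp: \<sigma>_def)
    have "1 = (y + z) * u + (x + z) * v + (x + y) * w" using r_1 by (simp add: weight_def r)
    also have "\<dots> = 2 * s * \<sigma>" by (simp add: uvw algebra_simps flip: s(1))
    finally have "\<sigma> = 1 / (2 * s)" using s(2) by (simp add: field_simps)
    then show "u = x / (2 * s) \<and> v = y / (2 * s) \<and> w = z / (2 * s)" by (simp add: uvw)
  next
    assume uvw: "u = x / (2 * s) \<and> v = y / (2 * s) \<and> w = z / (2 * s)"
    then have "u + v + w = 1 / (2 * s)" using xyz_1 by (simp flip: add_divide_distrib)
    then show "u = x * (u + v + w) \<and> v = y * (u + v + w) \<and> w = z * (u + v + w)"
      using uvw by simp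
  qed
  also have "\<dots> \<longleftrightarrow> r = (1 / (2 * s)) *\<^sub>R vector [x * (y + z), y * (x + z), z * (x + y)]"
    using sums by (auto simp: vec_eq_iff forall_3 u_def v_def w_def divide_eq_eq mult.commute)
  finally show ?thesis .
qed

theorem theorem3p11:
  fixes A B C :: "real^2" and P :: point
  assumes "\<not> collinear {A, B, C}"
    and "P \<notin> line_at_infinity"
    and "P \<notin> triangle_sides (Ordinary A) (Ordinary B) (Ordinary C)"
    and "P \<notin> anticomplementary_sides A B C"
    and "P \<notin> steiner_circumellipse A B C"
  shows "{X. X \<notin> line_at_infinity \<and> cevian_map A B C P X = X} = {isotomcomplement A B C P}"
proof -
  interpret triangle A B C using assms(1) by unfold_locales
  obtain p where "p \<noteq> 0" "P = bary p" by (rule bary_surj)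
  moreover obtain x0 y0 z0 where "p = vector [x0, y0, z0]" by (rule vector_3_cases)
  moreover define \<tau> where "\<tau> = x0 + y0 + z0"
  ultimately have "\<tau> \<noteq> 0" using assms(2) by (simp add: bary_infinite_iff weight_def)
  \<comment> \<open>With weight \<open>1\<close> the sums in the fixed point equations become \<open>y + z = 1 - x\<close> and so on.\<close>
  define x y z where "x = x0 / \<tau>" and "y = y0 / \<tau>" and "z = z0 / \<tau>"
  have "p = \<tau> *\<^sub>R vector [x, y, z]"
    using \<open>\<tau> \<noteq> 0\<close> by (simp add: \<open>p = _\<close> x_def y_def z_def scaleR_vector_3)
  then have P: "P = bary (vector [x, y, z])" and nz: "vector [x, y, z] \<noteq> (0 :: real^3)"
    using \<open>P = bary p\<close> \<open>p \<noteq> 0\<close> \<open>\<tau> \<noteq> 0\<close> by (auto simp: bary_scale)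
  have xyz_1: "x + y + z = 1"
    using \<open>\<tau> \<noteq> 0\<close> by (simp add: x_def y_def z_def \<tau>_def flip: add_divide_distrib)
  have xyz: "x \<noteq> 0" "y \<noteq> 0" "z \<noteq> 0"
    using assms(3) nz by (simp_all add: P in_triangle_sides_iff)
  have sums: "y + z \<noteq> 0" "x + z \<noteq> 0" "x + y \<noteq> 0"
    using assms(4) nz by (simp_all add: P in_anticomplementary_sides_iff)
  define s where "s = y * z + x * z + x * y"
  have "s \<noteq> 0" using assms(5) steiner_circumellipse_bary[OF xyz] by (auto simp: P s_def)
  define D where "D = comb A B C ((1 / (y + z)) *\<^sub>R vector [0, y, z])"
  define E where "E = comb A B C ((1 / (x + z)) *\<^sub>R vector [x, 0, z])"
  define F where "F = comb A B C ((1 / (x + y)) *\<^sub>R vector [x, y, 0])"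
  have feet: "cevian_foot P A B C = Ordinary D" "cevian_foot P B A C = Ordinary E"
    "cevian_foot P C A B = Ordinary F"
    using sums unfolding P cevian_feet[OF xyz]
    by (simp_all add: bary_def weight_def D_def E_def F_def)
  define M where "M = cevian_matrix x y z"
  have comb_DEF: "comb D E F r = comb A B C (M r)" for r
    by (simp add: comb_def D_def E_def F_def M_def cevian_matrix_def Let_def algebra_simps)
  have weight_M: "weight (M r) = weight r" for r
    unfolding M_def by (rule weight_cevian_matrix[OF sums])
  \<comment> \<open>An affine dependence between \<open>D\<close>, \<open>E\<close>, \<open>F\<close> would lie in the kernel of the matrix, which
    is trivial since \<open>x\<close>, \<open>y\<close>, \<open>z\<close> are nonzero.\<close>
  have "\<not> collinear {D, E, F}"
  proof
    assume "collinear {D, E, F}"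
    then obtain r where r: "r \<noteq> 0" "weight r = 0" "comb D E F r = 0"
      unfolding collinear_iff_dependent by blast
    then have "M r = 0" by (intro coordinates_unique) (simp_all add: comb_DEF weight_M)
    then show False using cevian_matrix_eq_0D[OF xyz sums] r(1) by (simp add: M_def)
  qed
  then have T: "affine_map (cevian_map A B C P) \<and> cevian_map A B C P (Ordinary A) = Ordinary D \<and>
      cevian_map A B C P (Ordinary B) = Ordinary E \<and> cevian_map A B C P (Ordinary C) = Ordinary F"
    unfolding cevian_map_def feet by (rule theI'[OF affine_map_exists_unique[OF assms(1)]])
  define q where "q = (1 / (2 * s)) *\<^sub>R (vector [x * (y + z), y * (x + z), z * (x + y)] :: real^3)"
  have weight_q: "weight q = 1"
  proof -
    have "weight (vector [x * (y + z), y * (x + z), z * (x + y)]) = 2 * s"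
      by (simp add: weight_def s_def algebra_simps)
    then show ?thesis using \<open>s \<noteq> 0\<close> by (simp add: q_def)
  qed
  have M_fixed_iff: "M r = r \<longleftrightarrow> r = q" if "weight r = 1" for r
    unfolding M_def q_def
    using cevian_matrix_fixed_iff[OF sums xyz_1 s_def[symmetric] \<open>s \<noteq> 0\<close> that] .
  have fixed_iff: "cevian_map A B C P (Ordinary X) = Ordinary X \<longleftrightarrow> X = comb A B C q" for X
  proof -
    obtain r where r: "comb A B C r = X" "weight r = 1" by (rule coordinates_exist)
    have "cevian_map A B C P (Ordinary X) = Ordinary (comb A B C (M r))"
      using affine_map_comb[of _ A D B E C F r] T r by (simp add: comb_DEF)
    then have "cevian_map A B C P (Ordinary X) = Ordinary X \<longleftrightarrow> M r = r"
      using coordinates_unique[of "M r" r] r by (auto simp: weight_M)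
    also have "\<dots> \<longleftrightarrow> X = comb A B C q"
      using M_fixed_iff[OF r(2)] coordinates_unique[of r q] r weight_q by auto
    finally show ?thesis .
  qed
  have "isotomcomplement A B C P = Ordinary (comb A B C q)"
    unfolding P q_def by (rule isotomcomplement_bary[OF xyz s_def[symmetric] \<open>s \<noteq> 0\<close>])
  moreover have "X \<notin> line_at_infinity \<and> cevian_map A B C P X = X \<longleftrightarrow> X = Ordinary (comb A B C q)" for X
    using fixed_iff by (cases X) (auto simp: line_at_infinity_def)
  ultimately show ?thesis by auto
qed

end
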